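(* Let $R=\{1,\dots,|R|\}$ be a finite nonempty set of call types with parameters $\nu_r>0$, $\mu_r>0$, $\kappa_r=\nu_r/\mu_r$ ($r\in R$), and let $c_0<\infty$ and $c_r\in(0,\infty]$ ($r\in R$) satisfy $c_0\le\sum_{r\in R}c_r$. Let feasibility of a control $\boldsymbol{b}$ mean that, for all $\boldsymbol{n}\in\mathbb{Z}_+^{|R|}$, $$\sum_{r\in R}b_r(\boldsymbol{n})\le c_0,\qquad b_r(\boldsymbol{n})\le c_r\quad (r\in R).$$ Assume that $$\sum_{r\in R}\kappa_r<c_0,\qquad \kappa_r<c_r\quad(r\in R).$$ For $\boldsymbol{n}\in\mathbb{Z}_+^{|R|}$ put $n_{\min}=\min_{r\in R}n_r$. Then, given any $\delta>0$, there is some $a\ge1$ (depending only on $\nu_r,\mu_r,c_j$ and $\delta$) such that every Pareto efficient control $\boldsymbol{b}$ for which there exists a finite set $F\subset\mathbb{Z}_+^{|R|}$ with $$\sum_{r:\,n_r\ge a'}(\kappa_r-b_r(\boldsymbol{n}))\le-\delta\qquad\text{for all } a'\in[1,a] \text{ and all } \boldsymbol{n}\notin F \text{ with } n_{\min}<a$$ is stable.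
   Context: $\mathbb{Z}_+=\{0,1,2,\dots\}$. A control is a function $\boldsymbol{b}=(b_r,\,r\in R):\mathbb{Z}_+^{|R|}\to[0,\infty)^{|R|}$ with $b_r(\boldsymbol{n})=0$ whenever $n_r=0$. It defines the continuous-time Markov process $\boldsymbol{n}(\cdot)$ on $\mathbb{Z}_+^{|R|}$ with transitions, for $r\in R$: $\boldsymbol{n}\to\boldsymbol{n}+\boldsymbol{e}_r$ at rate $\nu_r$ and $\boldsymbol{n}\to\boldsymbol{n}-\boldsymbol{e}_r$ at rate $\mu_r b_r(\boldsymbol{n})$, where $\boldsymbol{e}_r$ is the unit vector in coordinate $r$. The control is stable if this process is positive recurrent. Each call type $r$ uses a dedicated resource of capacity $c_r$ (the value $\infty$ meaning that there is no constraint) and a resource $0$ of capacity $c_0$ shared by all types. For a feasible control, resource $0$ is saturated at $\boldsymbol{n}$ if $\sum_{r\in R}b_r(\boldsymbol{n})=c_0$, and resource $r\in R$ is saturated at $\boldsymbol{n}$ if $b_r(\boldsymbol{n})=c_r$. A control is Pareto efficient if it is feasible and, for all $\boldsymbol{n}$ and all $r\in R$ with $n_r>0$, resource $0$ or resource $r$ is saturated at $\boldsymbol{n}$. *)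

theory Defs
  imports "HOL-Probability.Probability"
begin

section \<open>Continuous-time Markov chains and positive recurrence\<close>

text \<open>
  A chain on a countable state space is given by its transition rates \<open>q x y\<close> for \<open>y \<noteq> x\<close>;
  the diagonal of \<open>q\<close> is ignored.  It is built from its jump chain and its holding times:
  in state \<open>x\<close> it waits an exponential time with rate \<open>exit_rate q x\<close> and then jumps,
  independently of the waiting time, according to \<open>jump_pmf q x\<close>.
\<close>

definition exit_rate :: "('s \<Rightarrow> 's \<Rightarrow> real) \<Rightarrow> 's \<Rightarrow> real" where
  "exit_rate q x = (\<Sum>\<^sub>\<infinity>y\<in>-{x}. q x y)"

definition jump_pmf :: "('s \<Rightarrow> 's \<Rightarrow> real) \<Rightarrow> 's \<Rightarrow> 's pmf" where
  "jump_pmf q x =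
     (if exit_rate q x = 0 then return_pmf x
      else embed_pmf (\<lambda>y. if y = x then 0 else q x y / exit_rate q x))"

text \<open>
  The randomness of the \<open>k\<close>-th step is a pair \<open>(\<xi>, \<phi>)\<close>, independent of the other steps: \<open>\<xi>\<close> is
  a standard exponential variable and, independently of \<open>\<xi>\<close> and for all states \<open>x\<close>
  independently, \<open>\<phi> x\<close> is distributed according to \<open>jump_pmf q x\<close>.  Only the value of \<open>\<phi>\<close> at
  the current state is ever used, so that, given the past and the current state \<open>x\<close>, the
  holding time \<open>\<xi> / exit_rate q x\<close> and the next state \<open>\<phi> x\<close> have the required joint law.
\<close>

definition step_space :: "('s \<Rightarrow> 's \<Rightarrow> real) \<Rightarrow> (real \<times> ('s \<Rightarrow> 's)) measure" where
  "step_space q =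
     density lborel (exponential_density 1) \<Otimes>\<^sub>M (\<Pi>\<^sub>M x\<in>UNIV. measure_pmf (jump_pmf q x))"

definition path_space :: "('s \<Rightarrow> 's \<Rightarrow> real) \<Rightarrow> (real \<times> ('s \<Rightarrow> 's)) stream measure" where
  "path_space q = stream_space (step_space q)"

primrec jump_chain :: "'s \<Rightarrow> (real \<times> ('s \<Rightarrow> 's)) stream \<Rightarrow> nat \<Rightarrow> 's" where
  "jump_chain x \<omega> 0 = x"
| "jump_chain x \<omega> (Suc k) = snd (\<omega> !! k) (jump_chain x \<omega> k)"

text \<open>In \<^typ>\<open>ennreal\<close>, division of a positive number by \<open>0\<close> gives \<open>\<infinity>\<close>: an absorbing
  state is never left.\<close>

definition holding_time ::
  "('s \<Rightarrow> 's \<Rightarrow> real) \<Rightarrow> 's \<Rightarrow> (real \<times> ('s \<Rightarrow> 's)) stream \<Rightarrow> nat \<Rightarrow> ennreal" where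
  "holding_time q x \<omega> k = ennreal (fst (\<omega> !! k)) / ennreal (exit_rate q (jump_chain x \<omega> k))"

definition jump_time ::
  "('s \<Rightarrow> 's \<Rightarrow> real) \<Rightarrow> 's \<Rightarrow> (real \<times> ('s \<Rightarrow> 's)) stream \<Rightarrow> nat \<Rightarrow> ennreal" where
  "jump_time q x \<omega> k = (\<Sum>j<k. holding_time q x \<omega> j)"

text \<open>The state at time \<open>t\<close> of the (minimal) process started in \<open>x\<close>; \<^const>\<open>None\<close> from the
  explosion time on.\<close>

definition state_at ::
  "('s \<Rightarrow> 's \<Rightarrow> real) \<Rightarrow> 's \<Rightarrow> (real \<times> ('s \<Rightarrow> 's)) stream \<Rightarrow> real \<Rightarrow> 's option" where
  "state_at q x \<omega> t =
     (if \<exists>k. jump_time q x \<omega> k \<le> ennreal t \<and> ennreal t < jump_time q x \<omega> (Suc k)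
      then Some (jump_chain x \<omega>
        (THE k. jump_time q x \<omega> k \<le> ennreal t \<and> ennreal t < jump_time q x \<omega> (Suc k)))
      else None)"

definition return_time ::
  "('s \<Rightarrow> 's \<Rightarrow> real) \<Rightarrow> 's \<Rightarrow> (real \<times> ('s \<Rightarrow> 's)) stream \<Rightarrow> ennreal" where
  "return_time q x \<omega> =
     Inf {ennreal t |t. 0 \<le> t \<and> jump_time q x \<omega> 1 \<le> ennreal t \<and> state_at q x \<omega> t = Some x}"

definition positive_recurrent_state :: "('s \<Rightarrow> 's \<Rightarrow> real) \<Rightarrow> 's \<Rightarrow> bool" where
  "positive_recurrent_state q x \<longleftrightarrow>
     exit_rate q x = 0 \<or> (\<integral>\<^sup>+\<omega>. return_time q x \<omega> \<partial>path_space q) < \<infinity>"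

definition positive_recurrent :: "('s \<Rightarrow> 's \<Rightarrow> real) \<Rightarrow> bool" where
  "positive_recurrent q \<longleftrightarrow> (\<forall>x. positive_recurrent_state q x)"


section \<open>Controls\<close>

text \<open>The set of call types is a finite type \<open>'r\<close>; a state is a function \<open>'r \<Rightarrow> nat\<close>, and
  \<open>b n r\<close> is the capacity given to type \<open>r\<close> in state \<open>n\<close>.\<close>

definition control :: "(('r \<Rightarrow> nat) \<Rightarrow> 'r \<Rightarrow> real) \<Rightarrow> bool" where
  "control b \<longleftrightarrow> (\<forall>n r. 0 \<le> b n r) \<and> (\<forall>n r. n r = 0 \<longrightarrow> b n r = 0)"

text \<open>A departure of type \<open>r\<close> from \<open>n\<close> to \<open>m\<close> is written as \<open>n = m + e\<^sub>r\<close>, which avoids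
  truncated subtraction.\<close>

definition call_rate ::
  "('r::finite \<Rightarrow> real) \<Rightarrow> ('r \<Rightarrow> real) \<Rightarrow> (('r \<Rightarrow> nat) \<Rightarrow> 'r \<Rightarrow> real)
    \<Rightarrow> ('r \<Rightarrow> nat) \<Rightarrow> ('r \<Rightarrow> nat) \<Rightarrow> real" where
  "call_rate \<nu> \<mu> b n m =
     (\<Sum>r\<in>UNIV. if m = n(r := n r + 1) then \<nu> r else 0) +
     (\<Sum>r\<in>UNIV. if n = m(r := m r + 1) then \<mu> r * b n r else 0)"

definition stable_control ::
  "('r::finite \<Rightarrow> real) \<Rightarrow> ('r \<Rightarrow> real) \<Rightarrow> (('r \<Rightarrow> nat) \<Rightarrow> 'r \<Rightarrow> real) \<Rightarrow> bool" where
  "stable_control \<nu> \<mu> b \<longleftrightarrow> positive_recurrent (call_rate \<nu> \<mu> b)"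

definition feasible ::
  "real \<Rightarrow> ('r::finite \<Rightarrow> ereal) \<Rightarrow> (('r \<Rightarrow> nat) \<Rightarrow> 'r \<Rightarrow> real) \<Rightarrow> bool" where
  "feasible c0 c b \<longleftrightarrow>
     (\<forall>n. (\<Sum>r\<in>UNIV. b n r) \<le> c0 \<and> (\<forall>r. ereal (b n r) \<le> c r))"

definition pareto_efficient ::
  "real \<Rightarrow> ('r::finite \<Rightarrow> ereal) \<Rightarrow> (('r \<Rightarrow> nat) \<Rightarrow> 'r \<Rightarrow> real) \<Rightarrow> bool" where
  "pareto_efficient c0 c b \<longleftrightarrow>
     feasible c0 c b \<and>
     (\<forall>n r. 0 < n r \<longrightarrow> (\<Sum>s\<in>UNIV. b n s) = c0 \<or> ereal (b n r) = c r)"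

end

theory Submission
  imports Defs
begin

text \<open>
  Take \<open>a = k\<close> a natural number and the Lyapunov function
  \<open>V n = (\<Sum>r. f (n r) / \<mu> r)\<close> with \<open>f j - f (j - 1) = min j k\<close>.  Its drift at \<open>n\<close> is
  \<open>\<Sum>r. (\<kappa> r - b n r) * min (n r) k\<close> up to an error of at most \<open>\<Sum>r. \<kappa> r\<close>, which comes from
  the coordinates below \<open>k\<close> only.  As \<open>min (n r) k\<close> counts the levels \<open>i \<in> {1..k}\<close> with
  \<open>i \<le> n r\<close>, summing by levels and using the hypothesis for \<open>a' = 1, \<dots>, k\<close> bounds the drift by
  \<open>(\<Sum>r. \<kappa> r) - k * \<delta>\<close> if some coordinate is below \<open>k\<close>; otherwise resource 0 is saturated and
  the drift equals \<open>k * ((\<Sum>r. \<kappa> r) - c0)\<close>.  Both are negative for large \<open>k\<close>, and Foster's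
  criterion applies.

  To prove Foster's criterion for a target state \<open>z\<close>, correct \<open>V\<close> to a function whose drift is
  sufficiently negative at every state other than \<open>z\<close>, by subtracting a large multiple of
  a discounted probability of hitting \<open>z\<close>: this is subharmonic away from \<open>z\<close>, strictly so
  on the finite exceptional set, so it repairs that set without doing harm elsewhere.
\<close>

section \<open>Generator and hitting functionals of a chain\<close>

definition neighbours :: "('s \<Rightarrow> 's \<Rightarrow> real) \<Rightarrow> 's \<Rightarrow> 's set" where
  "neighbours q x = {y. y \<noteq> x \<and> q x y \<noteq> 0}"

text \<open>The generator of the chain applied to \<open>f\<close>. It is meaningful where
  \<open>neighbours q x\<close> is finite, since \<open>sum\<close> over an infinite set is
  0.\<close>

definition drift :: "('s \<Rightarrow> 's \<Rightarrow> real) \<Rightarrow> ('s \<Rightarrow> real) \<Rightarrow> 's \<Rightarrow> real" where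
  "drift q f x = (\<Sum>y\<in>neighbours q x. q x y * (f y - f x))"

text \<open>The \<open>+ 1\<close> per step makes the limit infinite on paths that never hit \<open>z\<close>, even on those
  along which the holding times are summable.\<close>

primrec hitting_cost ::
  "('s \<Rightarrow> 's \<Rightarrow> real) \<Rightarrow> 's \<Rightarrow> nat \<Rightarrow> 's \<Rightarrow> (real \<times> ('s \<Rightarrow> 's)) stream \<Rightarrow> ennreal" where
  "hitting_cost q z 0 x \<omega> = 0"
| "hitting_cost q z (Suc N) x \<omega> =
     (if x = z then 0
      else holding_time q x \<omega> 0 + 1 + hitting_cost q z N (snd (shd \<omega>) x) (stl \<omega>))"

text \<open>The expectation of \<open>(1 / 2) ^ \<tau>\<close> on \<open>\<tau> \<le> k\<close>, where \<open>\<tau>\<close> is the number of jumps before \<open>z\<close> is hit.\<close>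

primrec discounted_hit :: "('s \<Rightarrow> 's \<Rightarrow> real) \<Rightarrow> 's \<Rightarrow> nat \<Rightarrow> 's \<Rightarrow> real" where
  "discounted_hit q z 0 x = (if x = z then 1 else 0)"
| "discounted_hit q z (Suc k) x =
     (if x = z then 1
      else (\<Sum>y\<in>neighbours q x. q x y * discounted_hit q z k y) / (2 * exit_rate q x))"

section \<open>Pathwise bound on the return time\<close>

text \<open>\<open>jump_chain\<close> recurses on its last step. Peeling off the first step instead
  matches the decomposition of a stream into \<open>shd\<close> and \<open>stl\<close>, by which
  integrals over the path space are computed.\<close>

lemma jump_chain_Suc_shift:
  "jump_chain x \<omega> (Suc k) = jump_chain (snd (shd \<omega>) x) (stl \<omega>) k"
  by (induction k) simp_all

lemma holding_time_Suc_shift: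
  "holding_time q x \<omega> (Suc k) = holding_time q (snd (shd \<omega>) x) (stl \<omega>) k"
  unfolding holding_time_def jump_chain_Suc_shift by simp

lemma jump_time_Suc_shift:
  "jump_time q x \<omega> (Suc k) =
     holding_time q x \<omega> 0 + jump_time q (snd (shd \<omega>) x) (stl \<omega>) k"
  unfolding jump_time_def by (subst sum.lessThan_Suc_shift) (simp add: holding_time_Suc_shift)

lemma mono_jump_time: "mono (jump_time q x \<omega>)"
  unfolding jump_time_def mono_def by (auto intro!: sum_mono2)

lemma hitting_cost_eq:
  assumes "\<And>j. j < N \<Longrightarrow> jump_chain x \<omega> j \<noteq> z"
  shows "hitting_cost q z N x \<omega> = of_nat N + jump_time q x \<omega> N"
  using assms
proof (induction N arbitrary: x \<omega>)
  case (Suc N)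
  have "x \<noteq> z" using Suc.prems[of 0] by simp
  moreover have "jump_chain (snd (shd \<omega>) x) (stl \<omega>) j \<noteq> z" if "j < N" for j
    using Suc.prems[of "Suc j"] that unfolding jump_chain_Suc_shift by simp
  ultimately show ?case
    by (simp add: Suc.IH jump_time_Suc_shift add_ac)
qed (simp add: jump_time_def)

lemma incseq_hitting_cost: "incseq (\<lambda>N. hitting_cost q z N x \<omega>)"
proof (rule incseq_SucI)
  show "hitting_cost q z N x \<omega> \<le> hitting_cost q z (Suc N) x \<omega>" for N
  proof (induction N arbitrary: x \<omega>)
    case (Suc N)
    then show ?case by (subst (1 2) hitting_cost.simps(2)) (auto intro: add_left_mono)
  qed simp
qed

text \<open>Without a hit the unit charge per step would push the cost above every \<open>N\<close>.
  Up to the first hit the cost dominates the elapsed time, which gives the bound.\<close>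

lemma hits_if_hitting_cost_finite:
  assumes "(SUP N. hitting_cost q z N x \<omega>) < \<infinity>"
  obtains k where "jump_chain x \<omega> k = z"
    and "jump_time q x \<omega> k \<le> (SUP N. hitting_cost q z N x \<omega>)"
proof -
  let ?S = "SUP N. hitting_cost q z N x \<omega>"
  have ge: "hitting_cost q z N x \<omega> \<le> ?S" for N by (rule SUP_upper) simp
  have "\<exists>k. jump_chain x \<omega> k = z"
  proof (rule ccontr)
    assume no_hit: "\<not> ?thesis"
    have "of_nat N \<le> ?S" for N
    proof -
      have "hitting_cost q z N x \<omega> = of_nat N + jump_time q x \<omega> N"
        using no_hit by (intro hitting_cost_eq) auto
      then have "of_nat N \<le> hitting_cost q z N x \<omega>" by simp
      then show ?thesis using ge by (rule order_trans)
    qed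
    moreover have "\<exists>n. ?S < of_nat n"
      using assms by (intro ennreal_Ex_less_of_nat) simp
    ultimately show False by (meson not_le)
  qed
  \<comment> \<open>The first hit is taken because \<open>hitting_cost_eq\<close> requires that
    \<open>z\<close> was not visited before.\<close>
  then have hit: "jump_chain x \<omega> (LEAST k. jump_chain x \<omega> k = z) = z" by (rule LeastI_ex)
  have "hitting_cost q z (LEAST k. jump_chain x \<omega> k = z) x \<omega> =
      of_nat (LEAST k. jump_chain x \<omega> k = z) + jump_time q x \<omega> (LEAST k. jump_chain x \<omega> k = z)"
    by (intro hitting_cost_eq) (use not_less_Least in blast)
  then have "jump_time q x \<omega> (LEAST k. jump_chain x \<omega> k = z) \<le>
      hitting_cost q z (LEAST k. jump_chain x \<omega> k = z) x \<omega>" by simp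
  then have "jump_time q x \<omega> (LEAST k. jump_chain x \<omega> k = z) \<le> ?S"
    using ge by (rule order_trans)
  with hit show thesis by (rule that)
qed

text \<open>A positive holding time makes the interval that starts at the \<open>k\<close>-th jump
  nonempty, and monotonicity of the jump times makes these intervals disjoint, so the
  \<open>THE\<close> in \<open>state_at\<close> picks \<open>k\<close>.\<close>

lemma state_at_jump_time:
  assumes "ennreal t = jump_time q x \<omega> k" "0 < holding_time q x \<omega> k"
  shows "state_at q x \<omega> t = Some (jump_chain x \<omega> k)"
proof -
  let ?P = "\<lambda>k. jump_time q x \<omega> k \<le> ennreal t \<and> ennreal t < jump_time q x \<omega> (Suc k)"
  \<comment> \<open>Addition in \<open>ennreal\<close> is strictly monotone only for a finite
    summand; here the summand equals \<open>ennreal t\<close>.\<close>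
  have "jump_time q x \<omega> k + 0 < jump_time q x \<omega> k + holding_time q x \<omega> k"
    using assms by (metis add.right_neutral ennreal_add_left_cancel_less ennreal_neq_top infinity_ennreal_def)
  then have k: "?P k" using assms by (simp add: jump_time_def)
  moreover have "j = k" if "?P j" for j
  proof (rule ccontr)
    assume "j \<noteq> k"
    then consider "Suc j \<le> k" | "Suc k \<le> j" by linarith
    then show False
      using k that mono_jump_time[of q x \<omega>] by cases (meson leD monoD order.trans)+
  qed
  ultimately have "(THE k. ?P k) = k" by (intro the_equality)
  with k show ?thesis unfolding state_at_def by auto
qed

text \<open>If the path shifted by one step hits \<open>z\<close> after \<open>k\<close> jumps, the
  original path is at \<open>z\<close> at jump \<open>Suc k\<close>, whose time is an admissible
  candidate in the infimum. If the cost is infinite, the bound is trivial.\<close>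

lemma return_time_le:
  assumes pos: "\<And>k. 0 < fst (\<omega> !! k)" and exit_pos: "\<And>y. 0 < exit_rate q y"
  shows "return_time q z \<omega> \<le> holding_time q z \<omega> 0 +
    (SUP N. hitting_cost q z N (snd (shd \<omega>) z) (stl \<omega>))"
proof (cases "(SUP N. hitting_cost q z N (snd (shd \<omega>) z) (stl \<omega>)) < \<infinity>")
  case False
  then have top: "(SUP N. hitting_cost q z N (snd (shd \<omega>) z) (stl \<omega>)) = \<infinity>"
    by (metis infinity_ennreal_def top.not_eq_extremum)
  show ?thesis unfolding top by simp
next
  case True
  then obtain k where k: "jump_chain (snd (shd \<omega>) z) (stl \<omega>) k = z"
    and le: "jump_time q (snd (shd \<omega>) z) (stl \<omega>) k
        \<le> (SUP N. hitting_cost q z N (snd (shd \<omega>) z) (stl \<omega>))"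
    by (rule hits_if_hitting_cost_finite)
  have hold: "holding_time q z \<omega> j = ennreal (fst (\<omega> !! j) / exit_rate q (jump_chain z \<omega> j))" for j
    unfolding holding_time_def using pos[of j] exit_pos by (intro divide_ennreal) (auto simp: less_imp_le)
  \<comment> \<open>\<open>return_time\<close> ranges over real times only, so the jump time must be
    finite.\<close>
  have "jump_time q z \<omega> (Suc k) < \<infinity>"
    unfolding jump_time_def by (simp add: hold)
  then obtain t where t: "0 \<le> t" "ennreal t = jump_time q z \<omega> (Suc k)"
    by (metis ennreal_cases infinity_ennreal_def less_irrefl)
  have "0 < holding_time q z \<omega> (Suc k)"
    unfolding hold ennreal_less_zero_iff by (intro divide_pos_pos pos exit_pos)
  from state_at_jump_time[OF t(2) this] have "state_at q z \<omega> t = Some z"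
    unfolding jump_chain_Suc_shift k by simp
  moreover have "jump_time q z \<omega> 1 \<le> ennreal t"
    unfolding t(2) using mono_jump_time[of q z \<omega>] by (simp add: monoD)
  ultimately have "return_time q z \<omega> \<le> ennreal t"
    unfolding return_time_def using t(1) by (intro Inf_lower) blast
  also have "\<dots> \<le> holding_time q z \<omega> 0 +
      (SUP N. hitting_cost q z N (snd (shd \<omega>) z) (stl \<omega>))"
    unfolding t(2) jump_time_Suc_shift using le by (rule add_left_mono)
  finally show ?thesis .
qed

section \<open>Chains with finitely many neighbours and their jump law\<close>

lemma exit_rate_eq_sum_neighbours:
  assumes "finite (neighbours q x)"
  shows "exit_rate q x = (\<Sum>y\<in>neighbours q x. q x y)"
proof -
  have "exit_rate q x = (\<Sum>\<^sub>\<infinity>y\<in>neighbours q x. q x y)"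
    unfolding exit_rate_def by (rule infsum_cong_neutral) (auto simp: neighbours_def)
  then show ?thesis using assms by simp
qed

text \<open>Positive exit rates exclude absorbing states. Countability of the state type yields
  measurability of functions evaluated at the random next state.\<close>

locale finite_rate_chain =
  fixes q :: "'s::countable \<Rightarrow> 's \<Rightarrow> real"
  assumes rate_nonneg: "y \<noteq> x \<Longrightarrow> 0 \<le> q x y"
    and finite_neighbours: "finite (neighbours q x)"
    and exit_pos: "0 < exit_rate q x"
begin

lemma exit_rate_eq: "exit_rate q x = (\<Sum>y\<in>neighbours q x. q x y)"
  by (rule exit_rate_eq_sum_neighbours[OF finite_neighbours])

lemma drift_eq: "drift q f x = (\<Sum>y\<in>neighbours q x. q x y * f y) - exit_rate q x * f x"
  unfolding drift_def exit_rate_eq by (simp add: algebra_simps sum_subtractf sum_distrib_left)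

lemma neighbours_nonneg: "y \<in> neighbours q x \<Longrightarrow> 0 \<le> q x y"
  using rate_nonneg by (auto simp: neighbours_def)

text \<open>\<open>embed_pmf\<close> returns the given masses once these are known to be nonnegative
  with total 1; the total is 1 because \<open>exit_rate\<close> is the sum of the rates to the
  neighbours.\<close>

lemma pmf_jump_pmf:
  "pmf (jump_pmf q x) y = (if y \<in> neighbours q x then q x y / exit_rate q x else 0)"
proof -
  let ?f = "\<lambda>y. if y = x then 0 else q x y / exit_rate q x"
  have f: "?f y = (if y \<in> neighbours q x then q x y / exit_rate q x else 0)" for y
    by (auto simp: neighbours_def)
  have nn: "0 \<le> ?f y" for y
    using rate_nonneg[of y x] exit_pos[of x] by simp
  have "(\<integral>\<^sup>+y. ennreal (?f y) \<partial>count_space UNIV) = (\<Sum>y\<in>neighbours q x. ennreal (?f y))"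
    by (rule nn_integral_count_space') (use finite_neighbours f in auto)
  also have "\<dots> = ennreal (\<Sum>y\<in>neighbours q x. ?f y)"
    using nn by (intro sum_ennreal)
  also have "(\<Sum>y\<in>neighbours q x. ?f y) = (\<Sum>y\<in>neighbours q x. q x y / exit_rate q x)"
    by (intro sum.cong) (auto simp: neighbours_def)
  also have "\<dots> = 1"
    using exit_pos[of x] by (simp add: sum_divide_distrib[symmetric] exit_rate_eq[symmetric])
  finally have one: "(\<integral>\<^sup>+y. ennreal (?f y) \<partial>count_space UNIV) = 1" by simp
  have "jump_pmf q x = embed_pmf ?f"
    unfolding jump_pmf_def using exit_pos[of x] by simp
  then show ?thesis using pmf_embed_pmf[of ?f y, OF nn one] f by (simp only:)
qed

lemma nn_integral_jump_pmf:
  assumes "\<And>y. 0 \<le> W y"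
  shows "(\<integral>\<^sup>+y. ennreal (W y) \<partial>jump_pmf q x) =
    ennreal ((\<Sum>y\<in>neighbours q x. q x y * W y) / exit_rate q x)"
proof -
  have "(\<integral>\<^sup>+y. ennreal (W y) \<partial>jump_pmf q x) =
      (\<Sum>y\<in>neighbours q x. ennreal (W y) * ennreal (pmf (jump_pmf q x) y))"
    by (rule nn_integral_measure_pmf_support) (auto simp: finite_neighbours set_pmf_eq pmf_jump_pmf split: if_splits)
  also have "\<dots> = (\<Sum>y\<in>neighbours q x. ennreal (q x y * W y / exit_rate q x))"
    by (intro sum.cong refl) (simp add: pmf_jump_pmf ennreal_mult'[symmetric] assms mult.commute)
  also have "\<dots> = ennreal (\<Sum>y\<in>neighbours q x. q x y * W y / exit_rate q x)"
    using assms neighbours_nonneg exit_pos by (intro sum_ennreal) (simp add: less_imp_le)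
  finally show ?thesis by (simp add: sum_divide_distrib)
qed

section \<open>Integration over the step space and the path space\<close>

abbreviation "exponential \<equiv> density lborel (exponential_density 1)"
abbreviation "choices \<equiv> \<Pi>\<^sub>M x\<in>UNIV. measure_pmf (jump_pmf q x)"

lemma prob_space_exponential: "prob_space exponential"
  by (rule prob_space_exponential_density) simp

lemma prob_space_choices: "prob_space choices"
  by (intro prob_space_PiM measure_pmf.prob_space_axioms)

lemma prob_space_step: "prob_space (step_space q)"
proof -
  interpret E: prob_space exponential by (rule prob_space_exponential)
  interpret C: prob_space choices by (rule prob_space_choices)
  interpret pair_prob_space exponential choices ..
  show ?thesis unfolding step_space_def by (rule prob_space_axioms)
qed

lemma measurable_choice [measurable]:
  "(\<lambda>s. snd s x) \<in> measurable (step_space q) (count_space UNIV)"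
proof -
  have "(\<lambda>\<phi>. \<phi> x) \<in> measurable choices (jump_pmf q x)"
    by (rule measurable_component_singleton) simp
  then have "(\<lambda>\<phi>. \<phi> x) \<in> measurable choices (count_space UNIV)"
    by (simp add: measurable_def)
  then show ?thesis unfolding step_space_def by (rule measurable_compose[OF measurable_snd])
qed

lemma measurable_fst_step [measurable]: "fst \<in> borel_measurable (step_space q)"
proof -
  have "fst \<in> measurable (step_space q) exponential"
    unfolding step_space_def by (rule measurable_fst)
  then show ?thesis by simp
qed

lemma nn_integral_step_fst:
  assumes [measurable]: "g \<in> borel_measurable borel"
  shows "(\<integral>\<^sup>+s. g (fst s) \<partial>step_space q) = (\<integral>\<^sup>+u. g u \<partial>exponential)"
proof -
  interpret C: prob_space choices by (rule prob_space_choices)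
  have "(\<integral>\<^sup>+s. g (fst s) \<partial>step_space q) = (\<integral>\<^sup>+u. (\<integral>\<^sup>+\<phi>. g (fst (u, \<phi>)) \<partial>choices) \<partial>exponential)"
    unfolding step_space_def by (rule C.nn_integral_fst[symmetric]) measurable
  then show ?thesis by (simp add: C.emeasure_space_1)
qed

text \<open>Fubini integrates out the exponential factor first; the coordinate \<open>x\<close> of
  the remaining product measure has law \<open>jump_pmf q x\<close>.\<close>

lemma nn_integral_step_snd:
  "(\<integral>\<^sup>+s. g (snd s x) \<partial>step_space q) = (\<integral>\<^sup>+y. g y \<partial>jump_pmf q x)"
proof -
  interpret E: prob_space exponential by (rule prob_space_exponential)
  interpret C: prob_space choices by (rule prob_space_choices)
  interpret P: pair_prob_space exponential choices ..
  have [measurable]: "(\<lambda>\<phi>. \<phi> x) \<in> measurable choices (count_space UNIV)"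
    using measurable_component_singleton[of x UNIV "\<lambda>x. measure_pmf (jump_pmf q x)"]
    by (simp add: measurable_def)
  have "(\<integral>\<^sup>+s. g (snd s x) \<partial>step_space q) =
      (\<integral>\<^sup>+\<phi>. (\<integral>\<^sup>+u. g (snd (u, \<phi>) x) \<partial>exponential) \<partial>choices)"
    unfolding step_space_def by (rule P.nn_integral_snd[symmetric]) measurable
  also have "\<dots> = (\<integral>\<^sup>+\<phi>. g (\<phi> x) \<partial>choices)"
    using E.emeasure_space_1 by simp
  also have "\<dots> = (\<integral>\<^sup>+y. g y \<partial>distr choices (jump_pmf q x) (\<lambda>\<phi>. \<phi> x))"
    by (rule nn_integral_distr[symmetric]) (simp_all add: measurable_component_singleton)
  also have "distr choices (jump_pmf q x) (\<lambda>\<phi>. \<phi> x) = jump_pmf q x"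
    by (rule distr_PiM_component) (simp_all add: measure_pmf.prob_space_axioms)
  finally show ?thesis .
qed

lemma AE_step_pos: "AE s in step_space q. 0 < fst s"
proof -
  have "AE u in lborel. u \<noteq> (0::real)" by (rule AE_lborel_singleton)
  then have "AE u in exponential. 0 < u"
    by (subst AE_density) (auto simp: exponential_density_def)
  then have "(\<integral>\<^sup>+u. indicator {..0} u \<partial>exponential) = 0"
    by (subst nn_integral_0_iff_AE) auto
  then have "(\<integral>\<^sup>+s. indicator {..0} (fst s) \<partial>step_space q) = 0"
    by (subst nn_integral_step_fst) auto
  then have "AE s in step_space q. indicator {..0} (fst s) = (0::ennreal)"
    by (subst (asm) nn_integral_0_iff_AE) auto
  then show ?thesis by eventually_elim (auto simp: indicator_def split: if_splits)
qed

lemma nn_integral_step_holding: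
  "(\<integral>\<^sup>+s. ennreal (fst s) / ennreal (exit_rate q x) \<partial>step_space q) = ennreal (1 / exit_rate q x)"
proof -
  have "(\<integral>\<^sup>+u. ennreal u \<partial>exponential) =
      (\<integral>\<^sup>+u. ennreal (exponential_density 1 u) * ennreal u \<partial>lborel)"
    by (subst nn_integral_density) auto
  \<comment> \<open>The standard exponential density is the Erlang density with index 0, and its
    first moment is 1.\<close>
  also have "\<dots> = (\<integral>\<^sup>+u. ennreal (erlang_density 0 1 u * u ^ 1) \<partial>lborel)"
    by (intro nn_integral_cong) (auto simp: ennreal_mult' erlang_density_def)
  also have "\<dots> = 1" by (subst nn_integral_erlang_ith_moment) auto
  finally have "(\<integral>\<^sup>+s. ennreal (fst s) \<partial>step_space q) = 1" by (simp add: nn_integral_step_fst)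
  then show ?thesis
    using exit_pos[of x] by (subst nn_integral_divide) (auto simp: divide_ennreal[symmetric])
qed

lemma AE_path_pos: "AE \<omega> in path_space q. \<forall>k. 0 < fst (\<omega> !! k)"
proof -
  interpret S: prob_space "step_space q" by (rule prob_space_step)
  have "AE \<omega> in path_space q. stream_all (\<lambda>s. 0 < fst s) \<omega>"
    unfolding path_space_def by (rule S.AE_stream_all[OF _ AE_step_pos]) measurable
  then show ?thesis by eventually_elim (simp add: stream.pred_set sset_range)
qed

lemma measurable_shd_path: "shd \<in> measurable (path_space q) (step_space q)"
  unfolding path_space_def by (rule measurable_shd)

lemma measurable_stl_path: "stl \<in> measurable (path_space q) (path_space q)"
  unfolding path_space_def by (rule measurable_stl)

lemma measurable_hitting_cost [measurable]:
  "hitting_cost q z N x \<in> borel_measurable (path_space q)"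
proof (induction N arbitrary: x)
  case 0
  have "hitting_cost q z 0 x = (\<lambda>\<omega>. 0)" by auto
  then show ?case by simp
next
  case (Suc N)
  have "(\<lambda>\<omega>. hitting_cost q z N (snd (shd \<omega>) x) (stl \<omega>)) \<in> borel_measurable (path_space q)"
    \<comment> \<open>The starting point of the remaining path is random; since it takes countably
      many values, measurability for each fixed value suffices.\<close>
    by (rule measurable_compose_countable[where f = "\<lambda>y \<omega>. hitting_cost q z N y (stl \<omega>)"])
      (use measurable_compose[OF measurable_stl_path Suc.IH] measurable_compose[OF measurable_shd_path measurable_choice] in auto)
  moreover have "(\<lambda>\<omega>. holding_time q x \<omega> 0) \<in> borel_measurable (path_space q)"
    unfolding holding_time_def
    using measurable_compose[OF measurable_shd_path measurable_fst_step] by simp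
  ultimately have "(\<lambda>\<omega>. if x = z then 0 else holding_time q x \<omega> 0 + 1 +
      hitting_cost q z N (snd (shd \<omega>) x) (stl \<omega>)) \<in> borel_measurable (path_space q)"
    by simp
  moreover have "hitting_cost q z (Suc N) x = (\<lambda>\<omega>. if x = z then 0
      else holding_time q x \<omega> 0 + 1 + hitting_cost q z N (snd (shd \<omega>) x) (stl \<omega>))"
    by auto
  ultimately show ?case by simp
qed

lemma nn_integral_path:
  assumes "f \<in> borel_measurable (path_space q)"
  shows "(\<integral>\<^sup>+\<omega>. f \<omega> \<partial>path_space q) = (\<integral>\<^sup>+s. (\<integral>\<^sup>+\<omega>. f (s ## \<omega>) \<partial>path_space q) \<partial>step_space q)"
proof -
  interpret S: prob_space "step_space q" by (rule prob_space_step)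
  show ?thesis using assms unfolding path_space_def by (rule S.nn_integral_stream_space)
qed

lemma emeasure_path_space: "emeasure (path_space q) (space (path_space q)) = 1"
proof -
  interpret S: prob_space "step_space q" by (rule prob_space_step)
  interpret P: prob_space "path_space q"
    unfolding path_space_def by (rule S.prob_space_stream_space)
  show ?thesis by (rule P.emeasure_space_1)
qed

section \<open>Expected hitting cost and recurrence of a single state\<close>

text \<open>A step from \<open>x\<close> costs \<open>1 / exit_rate q x + 1\<close> on average,
  which is at most \<open>(1 + \<Lambda>) / exit_rate q x\<close>. The drift condition says that the
  mean of \<open>W\<close> falls by at least this amount in one jump, so \<open>W\<close> pays for
  all steps by induction.\<close>

lemma hitting_cost_le:
  assumes W: "\<And>y. 0 \<le> W y"
    and exit_le: "\<And>y. exit_rate q y \<le> \<Lambda>"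
    and drift_le: "\<And>y. y \<noteq> z \<Longrightarrow> drift q W y \<le> - (1 + \<Lambda>)"
  shows "(\<integral>\<^sup>+\<omega>. hitting_cost q z N x \<omega> \<partial>path_space q) \<le> ennreal (W x)"
proof (induction N arbitrary: x)
  case 0
  have "hitting_cost q z 0 x = (\<lambda>\<omega>. 0)" by auto
  then show ?case by simp
next
  case (Suc N)
  show ?case
  proof (cases "x = z")
    case False
    let ?h = "\<lambda>s. ennreal (fst s) / ennreal (exit_rate q x)"
    have "(\<integral>\<^sup>+\<omega>. hitting_cost q z (Suc N) x \<omega> \<partial>path_space q) =
        (\<integral>\<^sup>+s. (\<integral>\<^sup>+\<omega>. ?h s + 1 + hitting_cost q z N (snd s x) \<omega> \<partial>path_space q) \<partial>step_space q)"
      using False by (subst nn_integral_path) (simp_all add: holding_time_def del: hitting_cost.simps(1))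
    also have "\<dots> = (\<integral>\<^sup>+s. ?h s + 1 +
        (\<integral>\<^sup>+\<omega>. hitting_cost q z N (snd s x) \<omega> \<partial>path_space q) \<partial>step_space q)"
      by (intro nn_integral_cong) (simp add: nn_integral_add emeasure_path_space)
    also have "\<dots> \<le> (\<integral>\<^sup>+s. ?h s + 1 + ennreal (W (snd s x)) \<partial>step_space q)"
      by (intro nn_integral_mono add_left_mono Suc.IH)
    also have "\<dots> = ennreal (1 / exit_rate q x) + 1 + (\<integral>\<^sup>+y. ennreal (W y) \<partial>jump_pmf q x)"
    proof -
      have "(\<lambda>s. ennreal (W (snd s x))) \<in> borel_measurable (step_space q)"
        by measurable
      then show ?thesis
        using prob_space.emeasure_space_1[OF prob_space_step]
        by (simp add: nn_integral_add nn_integral_step_holding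
            nn_integral_step_snd[where g = "\<lambda>y. ennreal (W y)"])
    qed
    also have "\<dots> = ennreal (1 / exit_rate q x + 1 +
        (\<Sum>y\<in>neighbours q x. q x y * W y) / exit_rate q x)"
    proof -
      have "0 \<le> (\<Sum>y\<in>neighbours q x. q x y * W y) / exit_rate q x"
        using W exit_pos[of x] neighbours_nonneg by (simp add: sum_nonneg less_imp_le)
      then show ?thesis using exit_pos[of x] by (simp add: nn_integral_jump_pmf[OF W] less_imp_le)
    qed
    also have "\<dots> \<le> ennreal (W x)"
    proof (rule ennreal_leI)
      have "1 + exit_rate q x + (\<Sum>y\<in>neighbours q x. q x y * W y) \<le> exit_rate q x * W x"
        using drift_le[OF False] exit_le[of x] unfolding drift_eq by linarith
      then have "(1 + exit_rate q x + (\<Sum>y\<in>neighbours q x. q x y * W y)) / exit_rate q x \<le> W x"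
        using exit_pos[of x] by (simp add: pos_divide_le_eq mult.commute)
      then show "1 / exit_rate q x + 1 + (\<Sum>y\<in>neighbours q x. q x y * W y) / exit_rate q x \<le> W x"
        using exit_pos[of x] by (simp add: add_divide_distrib)
    qed
    finally show ?thesis .
  qed simp
qed

text \<open>No drift condition is available at \<open>z\<close> itself, so the first jump is treated
  separately. It leads to finitely many states, and the mean of \<open>W\<close> over them is
  finite.\<close>

lemma positive_recurrent_state_if_drift:
  assumes W: "\<And>y. 0 \<le> W y"
    and exit_le: "\<And>y. exit_rate q y \<le> \<Lambda>"
    and drift_le: "\<And>y. y \<noteq> z \<Longrightarrow> drift q W y \<le> - (1 + \<Lambda>)"
  shows "positive_recurrent_state q z"
proof -
  let ?S = "\<lambda>x \<omega>. SUP N. hitting_cost q z N x \<omega>"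
  let ?h = "\<lambda>s. ennreal (fst s) / ennreal (exit_rate q z)"
  have S_le: "(\<integral>\<^sup>+\<omega>. ?S x \<omega> \<partial>path_space q) \<le> ennreal (W x)" for x
  proof -
    have "(\<integral>\<^sup>+\<omega>. ?S x \<omega> \<partial>path_space q) =
        (SUP N. \<integral>\<^sup>+\<omega>. hitting_cost q z N x \<omega> \<partial>path_space q)"
      by (rule nn_integral_monotone_convergence_SUP)
        (use incseqD[OF incseq_hitting_cost] in \<open>auto simp: incseq_def le_fun_def\<close>)
    also have "\<dots> \<le> ennreal (W x)"
      by (intro SUP_least hitting_cost_le[OF assms])
    finally show ?thesis .
  qed
  have "(\<lambda>\<omega>. ?S (snd (shd \<omega>) z) (stl \<omega>)) \<in> borel_measurable (path_space q)"
    by (rule measurable_compose_countable[where f = "\<lambda>y \<omega>. ?S y (stl \<omega>)"])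
      (use measurable_compose[OF measurable_stl_path measurable_hitting_cost]
        measurable_compose[OF measurable_shd_path measurable_choice] in auto)
  moreover have "(\<lambda>\<omega>. ?h (shd \<omega>)) \<in> borel_measurable (path_space q)"
    using measurable_compose[OF measurable_shd_path measurable_fst_step] by simp
  ultimately have meas: "(\<lambda>\<omega>. ?h (shd \<omega>) + ?S (snd (shd \<omega>) z) (stl \<omega>))
      \<in> borel_measurable (path_space q)"
    by simp
  have "(\<integral>\<^sup>+\<omega>. return_time q z \<omega> \<partial>path_space q) \<le>
      (\<integral>\<^sup>+\<omega>. ?h (shd \<omega>) + ?S (snd (shd \<omega>) z) (stl \<omega>) \<partial>path_space q)"
  proof (rule nn_integral_mono_AE)
    show "AE \<omega> in path_space q. return_time q z \<omega> \<le> ?h (shd \<omega>) + ?S (snd (shd \<omega>) z) (stl \<omega>)"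
      using AE_path_pos
    proof eventually_elim
      case (elim \<omega>)
      then show ?case
        using return_time_le[of \<omega> q z] exit_pos by (simp add: holding_time_def)
    qed
  qed
  also have "\<dots> = (\<integral>\<^sup>+s. (\<integral>\<^sup>+\<omega>. ?h s + ?S (snd s z) \<omega> \<partial>path_space q) \<partial>step_space q)"
    by (subst nn_integral_path[OF meas]) simp
  also have "\<dots> = (\<integral>\<^sup>+s. ?h s + (\<integral>\<^sup>+\<omega>. ?S (snd s z) \<omega> \<partial>path_space q) \<partial>step_space q)"
    by (intro nn_integral_cong) (simp add: nn_integral_add emeasure_path_space)
  also have "\<dots> \<le> (\<integral>\<^sup>+s. ?h s + ennreal (W (snd s z)) \<partial>step_space q)"
    by (intro nn_integral_mono add_left_mono S_le)
  also have "\<dots> = ennreal (1 / exit_rate q z) + (\<integral>\<^sup>+y. ennreal (W y) \<partial>jump_pmf q z)"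
  proof -
    have "(\<lambda>s. ennreal (W (snd s z))) \<in> borel_measurable (step_space q)"
      by measurable
    then show ?thesis
      by (simp add: nn_integral_add nn_integral_step_holding
          nn_integral_step_snd[where g = "\<lambda>y. ennreal (W y)"])
  qed
  also have "\<dots> < \<infinity>" unfolding nn_integral_jump_pmf[OF W] by simp
  finally show ?thesis unfolding positive_recurrent_state_def by simp
qed

section \<open>Discounted hitting probabilities and Foster's criterion\<close>

lemma discounted_hit_nonneg: "0 \<le> discounted_hit q z k x"
proof (induction k arbitrary: x)
  case (Suc k)
  then show ?case
    using exit_pos[of x] neighbours_nonneg by (simp add: sum_nonneg less_imp_le)
qed simp

lemma discounted_hit_le_1: "discounted_hit q z k x \<le> 1"
proof (induction k arbitrary: x)
  case (Suc k)
  have "(\<Sum>y\<in>neighbours q x. q x y * discounted_hit q z k y) \<le> exit_rate q x"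
    unfolding exit_rate_eq using Suc neighbours_nonneg by (intro sum_mono) (simp add: mult_left_le)
  then show ?case using exit_pos[of x] by simp
qed simp

lemma discounted_hit_Suc_mono: "discounted_hit q z k x \<le> discounted_hit q z (Suc k) x"
proof (induction k arbitrary: x)
  case 0
  show ?case using discounted_hit_nonneg[of z "Suc 0" x] by (cases "x = z") auto
next
  case (Suc k)
  have "(\<Sum>y\<in>neighbours q x. q x y * discounted_hit q z k y) \<le>
      (\<Sum>y\<in>neighbours q x. q x y * discounted_hit q z (Suc k) y)"
    using neighbours_nonneg by (intro sum_mono mult_left_mono Suc)
  then show ?case
    using exit_pos[of x]
    by (subst (1 2) discounted_hit.simps(2)) (auto intro: divide_right_mono simp: less_imp_le)
qed

lemma incseq_discounted_hit: "incseq (\<lambda>k. discounted_hit q z k x)"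
  by (rule incseq_SucI) (rule discounted_hit_Suc_mono)

text \<open>Because of the discount 1/2, the mean over the next state is twice the value at
  \<open>x\<close> with horizon \<open>Suc k\<close>, hence at least twice the value with horizon
  \<open>k\<close>. The drift subtracts only one of the two copies.\<close>

lemma drift_discounted_hit:
  assumes "x \<noteq> z"
  shows "exit_rate q x * discounted_hit q z k x \<le> drift q (discounted_hit q z k) x"
proof -
  have "2 * exit_rate q x * discounted_hit q z k x \<le> 2 * exit_rate q x * discounted_hit q z (Suc k) x"
    using exit_pos[of x] discounted_hit_Suc_mono by (intro mult_left_mono) auto
  also have "\<dots> = (\<Sum>y\<in>neighbours q x. q x y * discounted_hit q z k y)"
    using assms exit_pos[of x] by simp
  finally show ?thesis unfolding drift_eq by simp
qed

text \<open>Induction along a path to \<open>z\<close>: each edge lengthens the horizon by one and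
  contributes a positive term.\<close>

lemma discounted_hit_pos:
  assumes "(x, z) \<in> {(x, y). y \<in> neighbours q x}\<^sup>*"
  shows "\<exists>k. 0 < discounted_hit q z k x"
  using assms
proof (induction rule: converse_rtrancl_induct)
  case base
  have "0 < discounted_hit q z 0 z" by simp
  then show ?case by blast
next
  case (step x y)
  then obtain k where k: "0 < discounted_hit q z k y" by blast
  have y: "y \<in> neighbours q x" using step by simp
  have "q x y \<noteq> 0" using y by (simp add: neighbours_def)
  then have "0 < q x y * discounted_hit q z k y"
    using k neighbours_nonneg[OF y] by simp
  also have "\<dots> \<le> (\<Sum>y\<in>neighbours q x. q x y * discounted_hit q z k y)"
    using y neighbours_nonneg discounted_hit_nonneg finite_neighbours
    by (intro member_le_sum) auto
  finally have "0 < discounted_hit q z (Suc k) x" using exit_pos[of x] by simp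
  then show ?case by blast
qed

lemma foster_lyapunov:
  assumes irreducible: "\<And>x z. (x, z) \<in> {(x, y). y \<in> neighbours q x}\<^sup>*"
    and V: "\<And>y. 0 \<le> V y"
    and exit_le: "\<And>y. exit_rate q y \<le> \<Lambda>"
    and \<epsilon>: "0 < \<epsilon>" and F: "finite F"
    and drift_le: "\<And>y. y \<notin> F \<Longrightarrow> drift q V y \<le> - \<epsilon>"
  shows "positive_recurrent q"
  unfolding positive_recurrent_def
proof
  fix z
  \<comment> \<open>This factor scales a drift of \<open>- \<epsilon>\<close> to the
    \<open>- (1 + \<Lambda>)\<close> that \<open>positive_recurrent_state_if_drift\<close>
    demands.\<close>
  define C where "C = (1 + \<Lambda>) / \<epsilon>"
  have \<Lambda>: "0 \<le> \<Lambda>" using exit_pos[of z] exit_le[of z] by simp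
  have C: "0 \<le> C" unfolding C_def using \<epsilon> \<Lambda> by simp
  \<comment> \<open>Finiteness of \<open>F\<close> and monotonicity in the horizon give one horizon
    that serves all of \<open>F\<close>.\<close>
  have "\<exists>m. \<forall>x\<in>F. 0 < discounted_hit q z m x"
    using F
  proof (induction F)
    case (insert x F)
    then obtain m where m: "\<forall>x\<in>F. 0 < discounted_hit q z m x" by blast
    obtain k where k: "0 < discounted_hit q z k x" using discounted_hit_pos[OF irreducible] by blast
    have "0 < discounted_hit q z (max m k) y" if "y \<in> insert x F" for y
      using that m k incseqD[OF incseq_discounted_hit, of m "max m k" z y]
        incseqD[OF incseq_discounted_hit, of k "max m k" z y]
      by fastforce
    then show ?case by blast
  qed simp
  then obtain m where m: "\<And>x. x \<in> F \<Longrightarrow> 0 < discounted_hit q z m x" by blast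
  define \<phi> where "\<phi> = discounted_hit q z m"
  \<comment> \<open>Each summand is enough to repair the drift at one state of \<open>F\<close>; the
    sum of absolute values dominates them all.\<close>
  define K where "K = (\<Sum>x\<in>F. \<bar>(C * drift q V x + 1 + \<Lambda>) / (exit_rate q x * \<phi> x)\<bar>)"
  have K: "0 \<le> K" unfolding K_def by (intro sum_nonneg) simp
  \<comment> \<open>Using \<open>1 - \<phi> x\<close> in place of \<open>- \<phi> x\<close> keeps
    \<open>W\<close> nonnegative and does not change the drift.\<close>
  define W where "W = (\<lambda>x. C * V x + K * (1 - \<phi> x))"
  have drift_W: "drift q W x = C * drift q V x - K * drift q \<phi> x" for x
    unfolding drift_def W_def by (simp add: sum_distrib_left sum_subtractf[symmetric] algebra_simps)
  have drift_\<phi>: "exit_rate q x * \<phi> x \<le> drift q \<phi> x" if "x \<noteq> z" for x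
    unfolding \<phi>_def by (rule drift_discounted_hit[OF that])
  have "drift q W x \<le> - (1 + \<Lambda>)" if x: "x \<noteq> z" for x
  proof (cases "x \<in> F")
    case True
    have pos: "0 < exit_rate q x * \<phi> x" unfolding \<phi>_def using m[OF True] exit_pos by simp
    have "(C * drift q V x + 1 + \<Lambda>) / (exit_rate q x * \<phi> x) \<le>
        \<bar>(C * drift q V x + 1 + \<Lambda>) / (exit_rate q x * \<phi> x)\<bar>" by (rule abs_ge_self)
    also have "\<dots> \<le> K" unfolding K_def by (rule member_le_sum) (use True F in auto)
    finally have "C * drift q V x + 1 + \<Lambda> \<le> K * (exit_rate q x * \<phi> x)"
      using pos by (simp add: pos_divide_le_eq)
    also have "\<dots> \<le> K * drift q \<phi> x" using drift_\<phi>[OF x] K by (rule mult_left_mono)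
    finally show ?thesis unfolding drift_W by simp
  next
    case False
    have "0 \<le> exit_rate q x * \<phi> x"
      unfolding \<phi>_def using exit_pos[of x] discounted_hit_nonneg by (simp add: less_imp_le)
    then have "0 \<le> K * drift q \<phi> x" using K drift_\<phi>[OF x] by simp
    moreover have "C * drift q V x \<le> C * - \<epsilon>" using C drift_le[OF False] by (rule mult_left_mono[rotated])
    moreover have "C * - \<epsilon> = - (1 + \<Lambda>)" unfolding C_def using \<epsilon> by simp
    ultimately show ?thesis unfolding drift_W by simp
  qed
  moreover have "0 \<le> W x" for x
    unfolding W_def \<phi>_def using C K V discounted_hit_le_1[of z m x] by simp
  ultimately show "positive_recurrent_state q z"
    using exit_le by (intro positive_recurrent_state_if_drift)
qed

end

section \<open>Rates, neighbours and irreducibility of the call process\<close>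

lemma call_rate_self [simp]: "call_rate \<nu> \<mu> b n n = 0"
proof -
  have "n \<noteq> n(r := n r + 1)" for r by (metis add_eq_self_zero fun_upd_same one_neq_zero)
  then show ?thesis unfolding call_rate_def by simp
qed

text \<open>Exchanging the sums leaves one arrival target and one departure target per type. At
  \<open>n r = 0\<close> the truncated \<open>n r - 1\<close> gives back \<open>n\<close>, which is
  harmless because \<open>b n r = 0\<close>.\<close>

lemma sum_call_rate:
  fixes g :: "('r::finite \<Rightarrow> nat) \<Rightarrow> real"
  assumes b: "control b" and A: "finite A"
    and up: "\<And>r. n(r := n r + 1) \<in> A"
    and down: "\<And>r. 0 < n r \<Longrightarrow> n(r := n r - 1) \<in> A"
  shows "(\<Sum>m\<in>A. call_rate \<nu> \<mu> b n m * g m) =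
    (\<Sum>r\<in>UNIV. \<nu> r * g (n(r := n r + 1))) + (\<Sum>r\<in>UNIV. \<mu> r * b n r * g (n(r := n r - 1)))"
proof -
  have "(\<Sum>m\<in>A. (if m = n(r := n r + 1) then \<nu> r else 0) * g m) = \<nu> r * g (n(r := n r + 1))" for r
    using A up[of r] by (simp add: if_distrib[where f = "\<lambda>x. x * _"] sum.delta cong: if_cong)
  moreover have "(\<Sum>m\<in>A. (if n = m(r := m r + 1) then \<mu> r * b n r else 0) * g m) =
      \<mu> r * b n r * g (n(r := n r - 1))" for r
  proof (cases "n r = 0")
    case True
    then have "b n r = 0" using b by (simp add: control_def)
    then show ?thesis by (auto intro!: sum.neutral)
  next
    case False
    have "n = m(r := m r + 1) \<longleftrightarrow> m = n(r := n r - 1)" for m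
    proof
      show "n = m(r := m r + 1) \<Longrightarrow> m = n(r := n r - 1)"
        by (metis add_diff_cancel_right' fun_upd_same fun_upd_triv fun_upd_upd)
      show "m = n(r := n r - 1) \<Longrightarrow> n = m(r := m r + 1)"
        using False by (simp add: fun_upd_def fun_eq_iff)
    qed
    then show ?thesis
      using A down[of r] False
      by (simp add: if_distrib[where f = "\<lambda>x. x * _"] sum.delta cong: if_cong)
  qed
  moreover have "(\<Sum>m\<in>A. call_rate \<nu> \<mu> b n m * g m) =
      (\<Sum>r\<in>UNIV. \<Sum>m\<in>A. (if m = n(r := n r + 1) then \<nu> r else 0) * g m) +
      (\<Sum>r\<in>UNIV. \<Sum>m\<in>A. (if n = m(r := m r + 1) then \<mu> r * b n r else 0) * g m)"
    unfolding call_rate_def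
    by (subst (1 2) sum.swap) (simp only: sum_distrib_right distrib_right sum.distrib)
  ultimately show ?thesis by simp
qed

text \<open>A finite superset of the neighbours that does not depend on the rates. It contains
  \<open>n\<close> itself when some coordinate is 0; \<open>call_rate_self\<close> makes that term
  vanish in sums.\<close>

definition adjacent :: "('r::finite \<Rightarrow> nat) \<Rightarrow> ('r \<Rightarrow> nat) set" where
  "adjacent n = range (\<lambda>r. n(r := n r + 1)) \<union> range (\<lambda>r. n(r := n r - 1))"

lemma finite_adjacent: "finite (adjacent n)"
  unfolding adjacent_def by simp

lemma neighbours_call_rate_subset: "neighbours (call_rate \<nu> \<mu> b) n \<subseteq> adjacent n"
proof
  fix m assume "m \<in> neighbours (call_rate \<nu> \<mu> b) n"
  then have "call_rate \<nu> \<mu> b n m \<noteq> 0" by (simp add: neighbours_def)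
  then consider r where "m = n(r := n r + 1)" | r where "n = m(r := m r + 1)"
  proof -
    have "\<exists>r. m = n(r := n r + 1) \<or> n = m(r := m r + 1)"
    proof (rule ccontr)
      assume "\<not> ?thesis"
      then have "call_rate \<nu> \<mu> b n m = 0" unfolding call_rate_def by simp
      with \<open>call_rate \<nu> \<mu> b n m \<noteq> 0\<close> show False ..
    qed
    then show thesis using that by blast
  qed
  then show "m \<in> adjacent n"
  proof cases
    case 2
    then have "m = n(r := n r - 1)" by simp
    then show ?thesis unfolding adjacent_def by blast
  qed (auto simp: adjacent_def)
qed

lemma sum_neighbours_call_rate:
  fixes g :: "('r::finite \<Rightarrow> nat) \<Rightarrow> real"
  assumes "control b"
  shows "(\<Sum>m\<in>neighbours (call_rate \<nu> \<mu> b) n. call_rate \<nu> \<mu> b n m * g m) =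
    (\<Sum>r\<in>UNIV. \<nu> r * g (n(r := n r + 1))) + (\<Sum>r\<in>UNIV. \<mu> r * b n r * g (n(r := n r - 1)))"
proof -
  have "(\<Sum>m\<in>neighbours (call_rate \<nu> \<mu> b) n. call_rate \<nu> \<mu> b n m * g m) =
      (\<Sum>m\<in>adjacent n. call_rate \<nu> \<mu> b n m * g m)"
  proof (rule sum.mono_neutral_left[OF finite_adjacent neighbours_call_rate_subset], rule ballI)
    fix m assume "m \<in> adjacent n - neighbours (call_rate \<nu> \<mu> b) n"
    then show "call_rate \<nu> \<mu> b n m * g m = 0"
      by (cases "m = n") (auto simp: neighbours_def)
  qed
  also have "\<dots> = (\<Sum>r\<in>UNIV. \<nu> r * g (n(r := n r + 1))) +
      (\<Sum>r\<in>UNIV. \<mu> r * b n r * g (n(r := n r - 1)))"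
    by (rule sum_call_rate[OF assms finite_adjacent]) (auto simp: adjacent_def)
  finally show ?thesis .
qed

lemma exit_rate_call_rate:
  assumes "control b"
  shows "exit_rate (call_rate \<nu> \<mu> b) n = (\<Sum>r\<in>UNIV. \<nu> r) + (\<Sum>r\<in>UNIV. \<mu> r * b n r)"
proof -
  have "exit_rate (call_rate \<nu> \<mu> b) n =
      (\<Sum>m\<in>neighbours (call_rate \<nu> \<mu> b) n. call_rate \<nu> \<mu> b n m)"
    by (rule exit_rate_eq_sum_neighbours)
      (rule finite_subset[OF neighbours_call_rate_subset finite_adjacent])
  then show ?thesis
    using sum_neighbours_call_rate[OF assms, of \<nu> \<mu> n "\<lambda>_. 1"] by simp
qed

lemma drift_call_rate:
  assumes "control b"
  shows "drift (call_rate \<nu> \<mu> b) f n =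
    (\<Sum>r\<in>UNIV. \<nu> r * (f (n(r := n r + 1)) - f n)) +
    (\<Sum>r\<in>UNIV. \<mu> r * b n r * (f (n(r := n r - 1)) - f n))"
  unfolding drift_def by (rule sum_neighbours_call_rate[OF assms])

lemma call_rate_nonneg:
  assumes "control b" "\<And>r. 0 < \<nu> r" "\<And>r. 0 < \<mu> r"
  shows "0 \<le> call_rate \<nu> \<mu> b n m"
  unfolding call_rate_def
  using assms by (intro add_nonneg_nonneg sum_nonneg) (auto simp: control_def less_imp_le)

lemma finite_rate_chain_call_rate:
  assumes b: "control b" and \<nu>: "\<And>r. 0 < \<nu> r" and \<mu>: "\<And>r. 0 < \<mu> r"
  shows "finite_rate_chain (call_rate \<nu> \<mu> b)"
proof
  fix n
  show "finite (neighbours (call_rate \<nu> \<mu> b) n)"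
    by (rule finite_subset[OF neighbours_call_rate_subset finite_adjacent])
  have "0 < (\<Sum>r\<in>UNIV. \<nu> r)" using \<nu> by (intro sum_pos) auto
  moreover have "0 \<le> (\<Sum>r\<in>UNIV. \<mu> r * b n r)"
    using b \<mu> by (intro sum_nonneg) (auto simp: control_def less_imp_le)
  ultimately show "0 < exit_rate (call_rate \<nu> \<mu> b) n"
    unfolding exit_rate_call_rate[OF b] by simp
qed (rule call_rate_nonneg[OF assms])

lemma arrival_neighbour:
  assumes "control b" "\<And>r. 0 < \<nu> r" "\<And>r. 0 < \<mu> r"
  shows "n(r := n r + 1) \<in> neighbours (call_rate \<nu> \<mu> b) n"
proof -
  have "\<nu> r \<le> (\<Sum>s\<in>UNIV. if n(r := n r + 1) = n(s := n s + 1) then \<nu> s else 0)"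
    using member_le_sum[of r UNIV "\<lambda>s. if n(r := n r + 1) = n(s := n s + 1) then \<nu> s else 0"] assms(2)
    by (simp add: less_imp_le)
  moreover have "0 \<le> (\<Sum>s\<in>UNIV. if n = (n(r := n r + 1))(s := (n(r := n r + 1)) s + 1)
      then \<mu> s * b n s else 0)"
    using assms(1,3) by (intro sum_nonneg) (auto simp: control_def less_imp_le)
  ultimately have "\<nu> r \<le> call_rate \<nu> \<mu> b n (n(r := n r + 1))"
    unfolding call_rate_def by linarith
  then have "call_rate \<nu> \<mu> b n (n(r := n r + 1)) \<noteq> 0" using assms(2)[of r] by linarith
  then show ?thesis unfolding neighbours_def by (cases "n(r := n r + 1) = n") auto
qed

lemma departure_neighbour:
  assumes "control b" "\<And>r. 0 < \<nu> r" "\<And>r. 0 < \<mu> r" "0 < b n r"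
  shows "n(r := n r - 1) \<in> neighbours (call_rate \<nu> \<mu> b) n"
proof -
  let ?m = "n(r := n r - 1)"
  have nr: "0 < n r" using assms(1,4) by (metis control_def less_irrefl neq0_conv)
  then have n: "n = ?m(r := ?m r + 1)" by (simp add: fun_upd_def fun_eq_iff)
  have "(if n = ?m(r := ?m r + 1) then \<mu> r * b n r else 0) \<le>
      (\<Sum>s\<in>UNIV. if n = ?m(s := ?m s + 1) then \<mu> s * b n s else 0)"
    by (rule member_le_sum) (use assms(1,3) in \<open>auto simp: control_def less_imp_le\<close>)
  moreover have "0 \<le> (\<Sum>s\<in>UNIV. if ?m = n(s := n s + 1) then \<nu> s else 0)"
    using assms(2) by (intro sum_nonneg) (auto simp: less_imp_le)
  moreover have "(if n = ?m(r := ?m r + 1) then \<mu> r * b n r else 0) = \<mu> r * b n r"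
    using n by (rule if_P)
  ultimately have "\<mu> r * b n r \<le> call_rate \<nu> \<mu> b n ?m"
    unfolding call_rate_def by linarith
  moreover have "0 < \<mu> r * b n r" using assms by simp
  ultimately have "call_rate \<nu> \<mu> b n ?m \<noteq> 0" by linarith
  then show ?thesis unfolding neighbours_def by (cases "?m = n") auto
qed

lemma sum_fun_upd_pred:
  fixes n :: "'r::finite \<Rightarrow> nat"
  assumes "0 < n r"
  shows "(\<Sum>s\<in>UNIV. (n(r := n r - 1)) s) < (\<Sum>s\<in>UNIV. n s)"
  using assms by (intro sum_strict_mono_ex1) auto

text \<open>The empty state serves as a hub: departures lead to it from everywhere, as some type is
  served in every other state, and arrivals lead from it to everywhere. Both inductions run on the
  total number of calls.\<close>

lemma call_rate_irreducible:
  assumes b: "control b" and \<nu>: "\<And>r. 0 < \<nu> r" and \<mu>: "\<And>r. 0 < \<mu> r"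
    and serve: "\<And>n r. 0 < n r \<Longrightarrow> \<exists>s. 0 < b n s"
  shows "(x, z) \<in> {(x, y). y \<in> neighbours (call_rate \<nu> \<mu> b) x}\<^sup>*" (is "_ \<in> ?E\<^sup>*")
proof -
  have "(x, \<lambda>_. 0) \<in> ?E\<^sup>*"
  proof (induction "\<Sum>r\<in>UNIV. x r" arbitrary: x rule: less_induct)
    case less
    show ?case
    proof (cases "x = (\<lambda>_. 0)")
      case False
      then obtain r where "0 < x r" by auto
      then obtain s where s: "0 < b x s" using serve by blast
      then have "0 < x s" using b by (metis control_def less_irrefl neq0_conv)
      then have "(x(s := x s - 1), \<lambda>_. 0) \<in> ?E\<^sup>*" by (intro less sum_fun_upd_pred)
      moreover have "(x, x(s := x s - 1)) \<in> ?E"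
        using departure_neighbour[where b = b and n = x and r = s, OF b \<nu> \<mu> s] by simp
      ultimately show ?thesis by (rule converse_rtrancl_into_rtrancl[rotated])
    qed simp
  qed
  moreover have "(\<lambda>_. 0, z) \<in> ?E\<^sup>*"
  proof (induction "\<Sum>r\<in>UNIV. z r" arbitrary: z rule: less_induct)
    case less
    show ?case
    proof (cases "z = (\<lambda>_. 0)")
      case False
      then obtain r where r: "0 < z r" by auto
      let ?y = "z(r := z r - 1)"
      have "?y(r := ?y r + 1) = z" using r by (simp add: fun_upd_def fun_eq_iff)
      then have "(?y, z) \<in> ?E"
        using arrival_neighbour[where b = b and n = ?y and r = r, OF b \<nu> \<mu>] by simp
      moreover have "(\<lambda>_. 0, ?y) \<in> ?E\<^sup>*" using r by (intro less sum_fun_upd_pred)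
      ultimately show ?thesis by (rule rtrancl_into_rtrancl[rotated])
    qed simp
  qed
  ultimately show ?thesis by (rule rtrancl_trans)
qed

section \<open>The Lyapunov function and its drift\<close>

text \<open>A discrete Huber function: it equals \<open>j * (j + 1) / 2\<close> up to
  \<open>k\<close> and is linear with slope \<open>k\<close> beyond.\<close>

definition truncated_square :: "nat \<Rightarrow> nat \<Rightarrow> real" where
  "truncated_square k j = (\<Sum>i=1..j. real (min i k))"

lemma truncated_square_Suc: "truncated_square k (j + 1) = truncated_square k j + real (min (j + 1) k)"
  unfolding truncated_square_def by simp

text \<open>At \<open>j = 0\<close> truncated subtraction leaves \<open>j\<close> unchanged and the
  increment \<open>min 0 k\<close> is 0, so no positivity assumption arises.\<close>

lemma truncated_square_pred:
  "truncated_square k (j - 1) = truncated_square k j - real (min j k)"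
  unfolding truncated_square_def by (cases j) simp_all

lemma truncated_square_nonneg: "0 \<le> truncated_square k j"
  unfolding truncated_square_def by (intro sum_nonneg) simp

text \<open>The weight \<open>1 / \<mu> r\<close> turns the rates \<open>\<nu> r\<close> and
  \<open>\<mu> r * b n r\<close> into \<open>\<kappa> r\<close> and \<open>b n r\<close>, the
  quantities compared in the stability condition.\<close>

definition lyapunov :: "('r::finite \<Rightarrow> real) \<Rightarrow> nat \<Rightarrow> ('r \<Rightarrow> nat) \<Rightarrow> real" where
  "lyapunov \<mu> k n = (\<Sum>r\<in>UNIV. truncated_square k (n r) / \<mu> r)"

lemma lyapunov_fun_upd:
  "lyapunov \<mu> k (n(r := j)) - lyapunov \<mu> k n = (truncated_square k j - truncated_square k (n r)) / \<mu> r"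
proof -
  have "lyapunov \<mu> k (n(r := j)) - lyapunov \<mu> k n =
      (\<Sum>s\<in>UNIV. if s = r then (truncated_square k j - truncated_square k (n r)) / \<mu> r else 0)"
    unfolding lyapunov_def sum_subtractf[symmetric]
    by (intro sum.cong) (auto simp: diff_divide_distrib)
  then show ?thesis by simp
qed

text \<open>An arrival gains \<open>min (n r + 1) k\<close> and a departure loses
  \<open>min (n r) k\<close>, up to the weight. These differ, by one, exactly when
  \<open>n r < k\<close>, which produces the second sum.\<close>

lemma drift_lyapunov:
  assumes b: "control b" and \<mu>: "\<And>r. 0 < \<mu> r"
  shows "drift (call_rate \<nu> \<mu> b) (lyapunov \<mu> k) n =
    (\<Sum>r\<in>UNIV. (\<nu> r / \<mu> r - b n r) * real (min (n r) k)) +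
    (\<Sum>r\<in>UNIV. if n r < k then \<nu> r / \<mu> r else 0)"
proof -
  have "\<nu> r * (lyapunov \<mu> k (n(r := n r + 1)) - lyapunov \<mu> k n) +
      \<mu> r * b n r * (lyapunov \<mu> k (n(r := n r - 1)) - lyapunov \<mu> k n) =
      (\<nu> r / \<mu> r - b n r) * real (min (n r) k) + (if n r < k then \<nu> r / \<mu> r else 0)" for r
  proof -
    have up: "lyapunov \<mu> k (n(r := n r + 1)) - lyapunov \<mu> k n = real (min (n r + 1) k) / \<mu> r"
      by (simp only: lyapunov_fun_upd truncated_square_Suc) simp
    have down: "lyapunov \<mu> k (n(r := n r - 1)) - lyapunov \<mu> k n = - real (min (n r) k) / \<mu> r"
      by (simp only: lyapunov_fun_upd truncated_square_pred) simp
    have "real (min (n r + 1) k) = real (min (n r) k) + (if n r < k then 1 else 0)" by auto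
    then show ?thesis
      unfolding up down using \<mu>[of r] by (simp add: algebra_simps add_divide_distrib)
  qed
  then show ?thesis unfolding drift_call_rate[OF b] by (simp add: sum.distrib[symmetric])
qed

text \<open>Layer-cake summation. The levels are compared as reals so that the inner sums have the
  form of the stability condition with \<open>a' = real i\<close>.\<close>

lemma sum_mult_min:
  fixes f :: "'r::finite \<Rightarrow> real"
  shows "(\<Sum>r\<in>UNIV. f r * real (min (n r) k)) = (\<Sum>i=1..k. \<Sum>r | real i \<le> real (n r). f r)"
proof -
  have "real (min j k) = (\<Sum>i=1..k. if i \<le> j then 1 else 0)" for j
  proof -
    have "(\<Sum>i=1..k. if i \<le> j then 1 else 0) = real (card {i\<in>{1..k}. i \<le> j})"
      by (simp add: sum.If_cases Int_def)
    also have "{i\<in>{1..k}. i \<le> j} = {1..min j k}" by auto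
    finally show ?thesis by simp
  qed
  then have "(\<Sum>r\<in>UNIV. f r * real (min (n r) k)) =
      (\<Sum>r\<in>UNIV. \<Sum>i=1..k. if i \<le> n r then f r else 0)"
    by (simp add: sum_distrib_left if_distrib[where f = "\<lambda>x. _ * x"] cong: if_cong)
  also have "\<dots> = (\<Sum>i=1..k. \<Sum>r\<in>UNIV. if i \<le> n r then f r else 0)" by (rule sum.swap)
  also have "\<dots> = (\<Sum>i=1..k. \<Sum>r | real i \<le> real (n r). f r)"
    by (simp add: sum.If_cases)
  finally show ?thesis .
qed

section \<open>Saturation of the shared resource and choice of the threshold\<close>

text \<open>Otherwise every dedicated resource is saturated, so all \<open>c r\<close> are finite
  and the allocations sum to at least \<open>c0\<close>; feasibility then forces equality.\<close>

lemma pareto_efficient_saturated: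
  assumes b: "pareto_efficient c0 c b" and c0: "ereal c0 \<le> (\<Sum>r\<in>UNIV. c r)"
    and pos: "\<And>r. 0 < n r"
  shows "(\<Sum>r\<in>UNIV. b n r) = c0"
proof (rule ccontr)
  assume ne: "\<not> ?thesis"
  then have "ereal (b n r) = c r" for r
    using b pos[of r] by (auto simp: pareto_efficient_def)
  then have "c r = ereal (b n r)" for r by simp
  then have "(\<Sum>r\<in>UNIV. c r) = ereal (\<Sum>r\<in>UNIV. b n r)" by simp
  then have "c0 \<le> (\<Sum>r\<in>UNIV. b n r)" using c0 by simp
  moreover have "(\<Sum>r\<in>UNIV. b n r) \<le> c0"
    using b by (simp add: pareto_efficient_def feasible_def)
  ultimately show False using ne by simp
qed

theorem mainTheorem3:
  fixes \<nu> \<mu> \<kappa> :: "'r::finite \<Rightarrow> real"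
    and c :: "'r \<Rightarrow> ereal"
    and c0 \<delta> :: real
  assumes "\<And>r. 0 < \<nu> r"
    and "\<And>r. 0 < \<mu> r"
    and "\<And>r. \<kappa> r = \<nu> r / \<mu> r"
    and "\<And>r. 0 < c r"
    and "ereal c0 \<le> (\<Sum>r\<in>UNIV. c r)"
    and "(\<Sum>r\<in>UNIV. \<kappa> r) < c0"
    and "\<And>r. ereal (\<kappa> r) < c r"
    and "0 < \<delta>"
  shows "\<exists>a::real. 1 \<le> a \<and>
    (\<forall>b. control b \<and> pareto_efficient c0 c b \<and>
       (\<exists>F. finite F \<and>
          (\<forall>a'\<in>{1..a}. \<forall>n. n \<notin> F \<and> real (Min (range n)) < a \<longrightarrow>
             (\<Sum>r | a' \<le> real (n r). \<kappa> r - b n r) \<le> - \<delta>))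
       \<longrightarrow> stable_control \<nu> \<mu> b)"
proof -
  note \<nu> = assms(1) and \<mu> = assms(2)
  let ?K = "\<Sum>r\<in>UNIV. \<kappa> r"
  have \<kappa>_pos: "0 < \<kappa> r" for r using assms(1-3) by simp
  then have K: "0 < ?K" by (intro sum_pos) auto
  \<comment> \<open>The gain \<open>k * \<delta>\<close> has to exceed the error \<open>?K\<close>
    by 1. The choice precedes \<open>b\<close> and \<open>F\<close>, so the threshold is uniform
    over controls.\<close>
  obtain k0 :: nat where "(?K + 1) / \<delta> \<le> real k0" using real_arch_simple by blast
  then have k0: "?K + 1 \<le> \<delta> * real k0" using assms(8) by (simp add: pos_divide_le_eq mult.commute)
  \<comment> \<open>The maximum with 1 ensures \<open>1 \<le> a\<close> and makes all coordinates
    positive once they are at least \<open>k\<close>.\<close>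
  define k where "k = max 1 k0"
  have "\<delta> * real k0 \<le> \<delta> * real k" unfolding k_def using assms(8) by simp
  then have k: "1 \<le> k" "?K + 1 \<le> \<delta> * real k" using k0 by (auto simp: k_def)
  have "stable_control \<nu> \<mu> b"
    if b: "control b" and pe: "pareto_efficient c0 c b" and F: "finite F"
      and cond: "\<forall>a'\<in>{1..real k}. \<forall>n. n \<notin> F \<and> real (Min (range n)) < real k \<longrightarrow>
             (\<Sum>r | a' \<le> real (n r). \<kappa> r - b n r) \<le> - \<delta>"
    for b F
  proof -
    interpret finite_rate_chain "call_rate \<nu> \<mu> b"
      by (rule finite_rate_chain_call_rate[OF b \<nu> \<mu>])
    \<comment> \<open>Either the allocations sum to \<open>c0\<close>, which is positive because it
      exceeds \<open>?K\<close>, or type \<open>r\<close> itself receives \<open>c r\<close>, which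
      is positive.\<close>
    have serve: "\<exists>s. 0 < b n s" if n: "0 < n r" for n r
    proof -
      have nonneg: "0 \<le> b n s" for s using b by (simp add: control_def)
      from pe n consider "(\<Sum>s\<in>UNIV. b n s) = c0" | "ereal (b n r) = c r"
        by (auto simp: pareto_efficient_def)
      then show ?thesis
      proof cases
        case 1
        then have "(\<Sum>s\<in>UNIV. b n s) \<noteq> 0" using K assms(6) by simp
        then obtain s where "b n s \<noteq> 0" by (meson sum.neutral)
        then show ?thesis using nonneg[of s] by (auto intro!: exI[of _ s])
      next
        case 2
        then have "0 < b n r" using assms(4)[of r] by (metis ereal_less(2))
        then show ?thesis ..
      qed
    qed
    have exit_le: "exit_rate (call_rate \<nu> \<mu> b) n \<le> (\<Sum>r\<in>UNIV. \<nu> r) + (\<Sum>r\<in>UNIV. \<mu> r * c0)" for n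
    proof -
      have "b n r \<le> c0" for r
      proof -
        have "b n r \<le> (\<Sum>s\<in>UNIV. b n s)"
          by (rule member_le_sum) (use b in \<open>auto simp: control_def\<close>)
        also have "\<dots> \<le> c0" using pe by (simp add: pareto_efficient_def feasible_def)
        finally show ?thesis .
      qed
      then show ?thesis
        unfolding exit_rate_call_rate[OF b] using \<mu>
        by (intro add_left_mono sum_mono mult_left_mono) (auto simp: less_imp_le)
    qed
    \<comment> \<open>The 1 in the minimum comes from states with a coordinate below
      \<open>k\<close>, and \<open>c0 - ?K\<close> from those with all coordinates at least
      \<open>k\<close>.\<close>
    have drift_le: "drift (call_rate \<nu> \<mu> b) (lyapunov \<mu> k) n \<le> - min 1 (c0 - ?K)" if n: "n \<notin> F" for n
    proof (cases "Min (range n) < k")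
      case True
      have "(\<Sum>r\<in>UNIV. (\<kappa> r - b n r) * real (min (n r) k)) \<le> (\<Sum>i=1..k. - \<delta>)"
        unfolding sum_mult_min
      proof (rule sum_mono)
        fix i assume "i \<in> {1..k}"
        then have "real i \<in> {1..real k}" by simp
        from bspec[OF cond this] n True
        show "(\<Sum>r | real i \<le> real (n r). \<kappa> r - b n r) \<le> - \<delta>" by simp
      qed
      moreover have "(\<Sum>r\<in>UNIV. if n r < k then \<kappa> r else 0) \<le> ?K"
        using \<kappa>_pos by (intro sum_mono) (simp add: less_imp_le)
      ultimately have "drift (call_rate \<nu> \<mu> b) (lyapunov \<mu> k) n \<le> - 1"
        unfolding drift_lyapunov[OF b \<mu>] assms(3)[symmetric] using k(2) by (simp add: mult.commute)
      then show ?thesis by linarith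
    next
      case False
      have ge: "k \<le> n r" for r
      proof -
        have "Min (range n) \<le> n r" by (intro Min_le) auto
        then show ?thesis using False by linarith
      qed
      have pos: "0 < n r" for r using ge[of r] k(1) by simp
      \<comment> \<open>With no coordinate below \<open>k\<close>, the error sum vanishes and every
        truncated coordinate is \<open>k\<close>.\<close>
      have "drift (call_rate \<nu> \<mu> b) (lyapunov \<mu> k) n = (\<Sum>r\<in>UNIV. (\<kappa> r - b n r) * real k)"
        unfolding drift_lyapunov[OF b \<mu>] assms(3)[symmetric] using ge
        by (simp add: min_absorb2 not_less[symmetric])
      also have "\<dots> = (?K - c0) * real k"
        using pareto_efficient_saturated[OF pe assms(5) pos]
        by (simp add: sum_distrib_right[symmetric] sum_subtractf)
      \<comment> \<open>The factor \<open>?K - c0\<close> is negative, so lowering \<open>k\<close>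
        to 1 increases the product.\<close>
      also have "\<dots> \<le> (?K - c0) * 1"
        using assms(6) k(1) by (intro mult_left_mono_neg) auto
      also have "\<dots> \<le> - min 1 (c0 - ?K)" by (simp add: min_def)
      finally show ?thesis .
    qed
    show ?thesis
      unfolding stable_control_def
    proof (rule foster_lyapunov[OF _ _ exit_le _ F drift_le])
      show "(x, z) \<in> {(x, y). y \<in> neighbours (call_rate \<nu> \<mu> b) x}\<^sup>*" for x z
        by (rule call_rate_irreducible[OF b \<nu> \<mu> serve])
      show "0 \<le> lyapunov \<mu> k n" for n
        unfolding lyapunov_def using \<mu> truncated_square_nonneg
        by (intro sum_nonneg divide_nonneg_pos) auto
      show "0 < min 1 (c0 - ?K)" using assms(6) by simp
    qed
  qed
  then show ?thesis using k(1) by (intro exI[of _ "real k"]) auto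
qed

end
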